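(* Fix an integer $N\ge 1$, a constant $L_\Psi>0$, and points $x_0,x^*\in\mathbb{R}^{q+1}$. Consider all choices of hyperparameters $(\alpha_k)_{k=1}^N,(\delta_k)_{k=1}^N,(\omega_k)_{k=1}^N$ with $\alpha_1=1$, $0<\alpha_k<1$ for $2\le k\le N$, $\delta_k>0$, $\omega_k>0$, such that, with $\Gamma_1=1$ and $\Gamma_k=(1-\alpha_k)\Gamma_{k-1}$ for $k\ge 2$, $$\alpha_k\delta_k\le\omega_k<\frac1{L_\Psi}\quad(k=1,\dots,N),\qquad \frac{\alpha_1}{\delta_1\Gamma_1}\ge\frac{\alpha_2}{\delta_2\Gamma_2}\ge\cdots\ge\frac{\alpha_N}{\delta_N\Gamma_N},$$ and such that $\delta_1=\omega_k=\omega$ for all $k=1,\dots,N$, for some $\omega>0$. Assume moreover $h=0$ (so $L_h=0$). Then, over all such choices, the complexity upper bound $$\left[\sum_{k=1}^{N}\Gamma_k^{-1}\omega_k(1-L_\Psi\omega_k)\right]^{-1}\left[\frac{\|x_0-x^*\|^2}{\delta_1}+\frac{2L_h}{\Gamma_N}\left(\|x^*\|^2+M^2\right)\right]=\left[\sum_{k=1}^{N}\Gamma_k^{-1}\omega(1-L_\Psi\omega)\right]^{-1}\frac{\|x_0-x^*\|^2}{\omega}$$ is minimized by $$\bar\alpha_1=1,\quad \bar\alpha_{k+1}=\frac{2}{1+\sqrt{1+4/\bar\alpha_k^2}},\qquad \bar\delta_{k+1}=\frac{\bar\omega}{\bar\alpha_{k+1}},\qquad \bar\omega=\frac{2}{3L_\Psi}$$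 (for $k=1,\dots,N-1$, with $\bar\delta_1=\bar\omega$).
   Context: Setting: the composite problem $\min_{x\in\mathbb{R}^{q+1}}\Psi(x)+\chi(x)$, $\Psi=f+h$, where $f$ is convex with $L_f$-Lipschitz gradient, $h$ is possibly nonconvex with $L_h$-Lipschitz gradient, $\chi$ is convex over a bounded domain, and $L_\Psi$ is a Lipschitz constant of $\nabla\Psi$. The accelerated gradient algorithm for this problem has hyperparameters $\alpha_k$ (damping), $\omega_k$ and $\delta_k$ (step sizes), starting point $x_0$; $x^*$ is a solution and $M$ a constant. The displayed expression is the known upper bound on the minimal squared norm of the generalized gradient over the first $N$ iterations. The theorem concerns only minimizing this expression over the admissible hyperparameters. *)

theory Defs
  imports "HOL-Analysis.Analysis"
begin

text \<open>All hyperparameter sequences are indexed by \<open>1, ..., N\<close>; values at other indices are irrelevant.\<close>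

fun Gamma_seq :: "(nat \<Rightarrow> real) \<Rightarrow> nat \<Rightarrow> real" where
  "Gamma_seq \<alpha> 0 = 1"  \<comment> \<open>never used\<close>
| "Gamma_seq \<alpha> (Suc 0) = 1"
| "Gamma_seq \<alpha> (Suc (Suc k)) = (1 - \<alpha> (Suc (Suc k))) * Gamma_seq \<alpha> (Suc k)"

definition admissible ::
  "nat \<Rightarrow> real \<Rightarrow> (nat \<Rightarrow> real) \<Rightarrow> (nat \<Rightarrow> real) \<Rightarrow> (nat \<Rightarrow> real) \<Rightarrow> bool" where
  "admissible N L\<Psi> \<alpha> \<delta> \<omega> \<longleftrightarrow>
     \<alpha> 1 = 1 \<and>
     (\<forall>k\<in>{2..N}. 0 < \<alpha> k \<and> \<alpha> k < 1) \<and>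
     (\<forall>k\<in>{1..N}. 0 < \<delta> k \<and> 0 < \<omega> k) \<and>
     (\<forall>k\<in>{1..N}. \<alpha> k * \<delta> k \<le> \<omega> k \<and> \<omega> k < 1 / L\<Psi>) \<and>
     (\<forall>k\<in>{1..<N}. \<alpha> k / (\<delta> k * Gamma_seq \<alpha> k) \<ge> \<alpha> (Suc k) / (\<delta> (Suc k) * Gamma_seq \<alpha> (Suc k)))"

definition constant_step ::
  "nat \<Rightarrow> (nat \<Rightarrow> real) \<Rightarrow> (nat \<Rightarrow> real) \<Rightarrow> real \<Rightarrow> bool" where
  "constant_step N \<delta> \<omega> w \<longleftrightarrow> 0 < w \<and> \<delta> 1 = w \<and> (\<forall>k\<in>{1..N}. \<omega> k = w)"

definition complexity_bound ::
  "nat \<Rightarrow> real \<Rightarrow> real \<Rightarrow> real \<Rightarrow> real ^ 'n \<Rightarrow> real ^ 'n \<Rightarrow>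
   (nat \<Rightarrow> real) \<Rightarrow> (nat \<Rightarrow> real) \<Rightarrow> (nat \<Rightarrow> real) \<Rightarrow> real" where
  "complexity_bound N L\<Psi> Lh M x0 xs \<alpha> \<delta> \<omega> =
     inverse (\<Sum>k=1..N. inverse (Gamma_seq \<alpha> k) * \<omega> k * (1 - L\<Psi> * \<omega> k)) *
     ((norm (x0 - xs))\<^sup>2 / \<delta> 1 + 2 * Lh / Gamma_seq \<alpha> N * ((norm xs)\<^sup>2 + M\<^sup>2))"

definition omega_bar :: "real \<Rightarrow> real" where
  "omega_bar L\<Psi> = 2 / (3 * L\<Psi>)"

fun alpha_bar :: "nat \<Rightarrow> real" where
  "alpha_bar 0 = 1"  \<comment> \<open>never used\<close>
| "alpha_bar (Suc 0) = 1"
| "alpha_bar (Suc (Suc k)) = 2 / (1 + sqrt (1 + 4 / (alpha_bar (Suc k))\<^sup>2))"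

definition delta_bar :: "real \<Rightarrow> nat \<Rightarrow> real" where
  "delta_bar L\<Psi> k = (if k = 1 then omega_bar L\<Psi> else omega_bar L\<Psi> / alpha_bar k)"

end

theory Submission imports Defs begin

text \<open>
  Telescoping the monotonicity constraint to \<open>k = 1\<close> and inserting \<open>\<delta>\<^sub>k \<le> \<omega> / \<alpha>\<^sub>k\<close>
  leaves only the restriction \<open>\<alpha>\<^sub>k\<^sup>2 \<le> \<Gamma>\<^sub>k\<close> on the damping parameters. The sequence
  \<open>alpha_bar\<close> is the one attaining equality everywhere, which makes every \<open>\<Gamma>\<^sub>k\<close> as
  small as possible. The bound factors as the squared distance divided by
  \<open>(\<Sum>k. 1 / \<Gamma>\<^sub>k) * \<omega>\<^sup>2 (1 - L \<omega>)\<close>, and the cubic is maximal at \<open>\<omega> = 2 / (3 L)\<close>.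
\<close>

lemma alpha_bar_bounds:
  assumes "k \<ge> 1"
  shows "0 < alpha_bar k \<and> alpha_bar k \<le> 1"
  using assms
proof (induction k rule: nat_induct_at_least)
  case base
  then show ?case by simp
next
  case (Suc k)
  then obtain j where k: "k = Suc j" by (cases k) auto
  have "1 + sqrt (1 + 4 / (alpha_bar k)\<^sup>2) \<ge> 2" by simp
  moreover have "0 < 2 / x \<and> 2 / x \<le> 1" if "x \<ge> 2" for x :: real
    using that by simp
  ultimately show ?case unfolding k alpha_bar.simps by blast
qed

lemma alpha_bar_Suc_less_1:
  assumes "k \<ge> 1"
  shows "alpha_bar (Suc k) < 1"
proof -
  obtain j where k: "k = Suc j" using assms by (cases k) auto
  have "sqrt (1 + 4 / (alpha_bar k)\<^sup>2) > 1"
    using alpha_bar_bounds[OF assms] by simp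
  then show ?thesis
    unfolding k alpha_bar.simps by (subst divide_less_eq_1_pos) linarith+
qed

text \<open>With \<open>a = alpha_bar k\<close>, the recursion is the rationalized formula for the
  positive root of \<open>t\<^sup>2 + a\<^sup>2 * t - a\<^sup>2 = 0\<close>.\<close>

lemma alpha_bar_Suc_square:
  assumes "k \<ge> 1"
  shows "(alpha_bar (Suc k))\<^sup>2 = (1 - alpha_bar (Suc k)) * (alpha_bar k)\<^sup>2"
proof -
  obtain j where k: "k = Suc j" using assms by (cases k) auto
  define a where "a = alpha_bar k"
  define s where "s = sqrt (1 + 4 / a\<^sup>2)"
  have "a > 0" using alpha_bar_bounds[OF assms] by (simp add: a_def)
  then have s: "s \<ge> 0" "(s\<^sup>2 - 1) * a\<^sup>2 = 4" by (auto simp: s_def)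
  have b: "alpha_bar (Suc k) = 2 / (1 + s)" by (simp add: k s_def a_def)
  \<comment> \<open>The left factor is \<open>(s - 1) / (1 + s)\<close>; expanding the fraction by
    \<open>1 + s\<close> produces \<open>s\<^sup>2 - 1\<close>, which the definition of
    \<open>s\<close> evaluates.\<close>
  have "(1 - 2 / (1 + s)) * a\<^sup>2 = (s\<^sup>2 - 1) * a\<^sup>2 / (1 + s)\<^sup>2"
    using s(1) by (simp add: divide_simps power2_eq_square) (simp add: algebra_simps)
  also have "\<dots> = (2 / (1 + s))\<^sup>2" by (simp add: s(2) power_divide)
  finally show ?thesis by (simp add: b a_def)
qed

lemma Gamma_seq_Suc: "k \<ge> 1 \<Longrightarrow> Gamma_seq \<alpha> (Suc k) = (1 - \<alpha> (Suc k)) * Gamma_seq \<alpha> k"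
  by (cases k) auto

text \<open>Both sides start at 1 and are multiplied by \<open>1 - alpha_bar (Suc k)\<close> in each
  step.\<close>

lemma Gamma_seq_alpha_bar:
  assumes "k \<ge> 1"
  shows "Gamma_seq alpha_bar k = (alpha_bar k)\<^sup>2"
  using assms
  by (induction k rule: nat_induct_at_least) (simp_all add: Gamma_seq_Suc alpha_bar_Suc_square)

lemma Gamma_seq_pos:
  assumes "k \<ge> 1" "\<forall>j\<in>{2..k}. \<alpha> j < 1"
  shows "Gamma_seq \<alpha> k > 0"
  using assms by (induction k rule: nat_induct_at_least) (auto simp: Gamma_seq_Suc)

lemma omega_bar_pos: "L\<Psi> > 0 \<Longrightarrow> omega_bar L\<Psi> > 0"
  by (simp add: omega_bar_def)

lemma omega_bar_less: "L\<Psi> > 0 \<Longrightarrow> omega_bar L\<Psi> < 1 / L\<Psi>"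
  by (simp add: omega_bar_def field_simps)

lemma admissible_bar:
  assumes L: "L\<Psi> > 0"
  shows "admissible N L\<Psi> alpha_bar (delta_bar L\<Psi>) (\<lambda>k. omega_bar L\<Psi>)"
proof -
  \<comment> \<open>The separate case \<open>k = 1\<close> is absorbed because
    \<open>alpha_bar 1 = 1\<close>.\<close>
  have delta: "delta_bar L\<Psi> k = omega_bar L\<Psi> / alpha_bar k" for k
    by (simp add: delta_bar_def)
  \<comment> \<open>The ratios are constant, so every monotonicity constraint is tight.\<close>
  have ratio: "alpha_bar k / (delta_bar L\<Psi> k * Gamma_seq alpha_bar k) = 1 / omega_bar L\<Psi>"
    if "k \<ge> 1" for k
    using alpha_bar_bounds[OF that] omega_bar_pos[OF L]
    by (simp add: delta Gamma_seq_alpha_bar[OF that] field_simps power2_eq_square)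
  have lt1: "alpha_bar k < 1" if "k \<ge> 2" for k
    using alpha_bar_Suc_less_1[of "k - 1"] that by simp
  show ?thesis
    using alpha_bar_bounds lt1 omega_bar_pos[OF L] omega_bar_less[OF L]
    by (auto simp: admissible_def ratio) (auto simp: delta field_simps less_imp_neq)
qed

lemma admissible_alpha_square_le:
  assumes adm: "admissible N L\<Psi> \<alpha> \<delta> \<omega>" and const: "constant_step N \<delta> \<omega> w"
    and k: "k \<in> {1..N}"
  shows "(\<alpha> k)\<^sup>2 \<le> Gamma_seq \<alpha> k"
proof -
  have w: "w > 0" "\<delta> 1 = w" "\<omega> k = w" using const k by (auto simp: constant_step_def)
  have "1 \<le> k" "k \<le> N" using k by auto
  \<comment> \<open>The chain ends at \<open>1 / w\<close> because \<open>\<alpha> 1 = 1\<close>,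
    \<open>Gamma_seq \<alpha> 1 = 1\<close> and \<open>\<delta> 1 = w\<close>.\<close>
  then have telescoped: "\<alpha> k / (\<delta> k * Gamma_seq \<alpha> k) \<le> 1 / w"
  proof (induction k rule: nat_induct_at_least)
    case base
    then show ?case using adm w by (simp add: admissible_def)
  next
    case (Suc j)
    then have "\<alpha> (Suc j) / (\<delta> (Suc j) * Gamma_seq \<alpha> (Suc j)) \<le> \<alpha> j / (\<delta> j * Gamma_seq \<alpha> j)"
      using adm by (simp add: admissible_def)
    with Suc show ?case by simp
  qed
  have G: "Gamma_seq \<alpha> k > 0"
    using k adm by (intro Gamma_seq_pos) (auto simp: admissible_def)
  have d: "\<delta> k > 0" "\<alpha> k * \<delta> k \<le> w"
    using adm k unfolding w(3)[symmetric] admissible_def by blast+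
  have a: "\<alpha> k > 0" using adm k by (cases "k = 1") (auto simp: admissible_def)
  have "\<alpha> k * w \<le> \<delta> k * Gamma_seq \<alpha> k"
    using telescoped G d(1) w(1) by (simp add: field_simps)
  \<comment> \<open>The extra factor \<open>\<alpha> k\<close> creates the product
    \<open>\<alpha> k * \<delta> k\<close>, whose bound \<open>w\<close> eliminates
    \<open>\<delta> k\<close>.\<close>
  then have "\<alpha> k * (\<alpha> k * w) \<le> \<alpha> k * \<delta> k * Gamma_seq \<alpha> k"
    using a by (simp add: mult.assoc)
  also have "\<dots> \<le> w * Gamma_seq \<alpha> k" using d(2) G by (intro mult_right_mono) auto
  finally have "w * (\<alpha> k)\<^sup>2 \<le> w * Gamma_seq \<alpha> k" by (simp add: power2_eq_square mult_ac)
  then show ?thesis using w(1) by simp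
qed

text \<open>The induction hypothesis suffices when the new \<open>\<alpha>\<close> is at most
  \<open>alpha_bar\<close>, since then the factor \<open>1 - \<alpha>\<close> is at least as large.
  A larger \<open>\<alpha>\<close> could shrink the product further, but then the square constraint
  itself bounds \<open>Gamma_seq \<alpha>\<close> below by the square of
  \<open>alpha_bar\<close>.\<close>

lemma Gamma_seq_alpha_bar_le:
  assumes "k \<ge> 1" and lt1: "\<forall>j\<in>{2..k}. \<alpha> j < 1"
    and sq: "\<forall>j\<in>{1..k}. (\<alpha> j)\<^sup>2 \<le> Gamma_seq \<alpha> j"
  shows "Gamma_seq alpha_bar k \<le> Gamma_seq \<alpha> k"
  using assms
proof (induction k rule: nat_induct_at_least)
  case base
  then show ?case by simp
next
  case (Suc k)
  have IH: "Gamma_seq alpha_bar k \<le> Gamma_seq \<alpha> k" using Suc by auto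
  have b: "0 < alpha_bar (Suc k)" "alpha_bar (Suc k) \<le> 1"
    using alpha_bar_bounds[of "Suc k"] by auto
  show ?case
  proof (cases "\<alpha> (Suc k) \<le> alpha_bar (Suc k)")
    case True
    have "Gamma_seq alpha_bar k \<ge> 0" using Suc.hyps by (simp add: Gamma_seq_alpha_bar)
    then show ?thesis using IH True b Suc.prems Suc.hyps
      by (auto simp: Gamma_seq_Suc intro!: mult_mono)
  next
    case False
    then have "(alpha_bar (Suc k))\<^sup>2 \<le> (\<alpha> (Suc k))\<^sup>2" using b by (intro power_mono) auto
    then show ?thesis using Suc.prems by (force simp: Gamma_seq_alpha_bar)
  qed
qed

lemma cubic_le_omega_bar:
  assumes L: "L\<Psi> > 0" and w: "w > 0"
  shows "w\<^sup>2 * (1 - L\<Psi> * w) \<le> (omega_bar L\<Psi>)\<^sup>2 * (1 - L\<Psi> * omega_bar L\<Psi>)"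
proof -
  define v where "v = omega_bar L\<Psi>"
  have v: "v > 0" "3 * (L\<Psi> * v) = 2" using L by (auto simp: v_def omega_bar_def)
  \<comment> \<open>The difference of the two sides has the double root \<open>w = v\<close>.\<close>
  have "2 * (v\<^sup>2 * (1 - L\<Psi> * v) - w\<^sup>2 * (1 - L\<Psi> * w)) =
      L\<Psi> * (w - v)\<^sup>2 * (2 * w + v) + (2 - 3 * (L\<Psi> * v)) * (v\<^sup>2 - w\<^sup>2)"
    by (simp add: power2_eq_square algebra_simps)
  \<comment> \<open>The last summand vanishes since \<open>3 * (L\<Psi> * v) = 2\<close>; the first
    is a product of nonnegative factors.\<close>
  also have "\<dots> \<ge> 0" using L v w by simp
  finally show ?thesis by (simp add: v_def)
qed

lemma complexity_bound_eq:
  assumes "Lh = 0" "constant_step N \<delta> \<omega> w"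
  shows "complexity_bound N L\<Psi> Lh M x0 xs \<alpha> \<delta> \<omega> =
    inverse (\<Sum>k=1..N. inverse (Gamma_seq \<alpha> k) * w * (1 - L\<Psi> * w)) * ((norm (x0 - xs))\<^sup>2 / w)"
proof -
  have "(\<Sum>k=1..N. inverse (Gamma_seq \<alpha> k) * \<omega> k * (1 - L\<Psi> * \<omega> k)) =
      (\<Sum>k=1..N. inverse (Gamma_seq \<alpha> k) * w * (1 - L\<Psi> * w))"
    using assms(2) by (intro sum.cong) (auto simp: constant_step_def)
  then show ?thesis using assms by (simp add: complexity_bound_def constant_step_def)
qed

text \<open>One \<open>w\<close> from the summands and one dividing the squared distance combine to
  \<open>w\<^sup>2\<close>. This separates \<open>\<alpha>\<close> from \<open>w\<close>, so the two
  factors of the denominator can be maximized independently.\<close>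

lemma complexity_bound_factored:
  assumes "Lh = 0" "constant_step N \<delta> \<omega> w"
  shows "complexity_bound N L\<Psi> Lh M x0 xs \<alpha> \<delta> \<omega> =
    (norm (x0 - xs))\<^sup>2 / ((\<Sum>k=1..N. inverse (Gamma_seq \<alpha> k)) * (w\<^sup>2 * (1 - L\<Psi> * w)))"
  unfolding complexity_bound_eq[OF assms]
  by (simp add: divide_inverse power2_eq_square mult_ac flip: sum_distrib_right sum_distrib_left)

lemma complexity_bound_bar_le:
  assumes N: "N \<ge> 1" and L: "L\<Psi> > 0" and Lh: "Lh = 0"
    and adm: "admissible N L\<Psi> \<alpha> \<delta> \<omega>" and const: "constant_step N \<delta> \<omega> w"
  shows "complexity_bound N L\<Psi> Lh M x0 xs alpha_bar (delta_bar L\<Psi>) (\<lambda>k. omega_bar L\<Psi>) \<le>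
    complexity_bound N L\<Psi> Lh M x0 xs \<alpha> \<delta> \<omega>"
proof -
  have const_bar: "constant_step N (delta_bar L\<Psi>) (\<lambda>k. omega_bar L\<Psi>) (omega_bar L\<Psi>)"
    by (simp add: constant_step_def delta_bar_def omega_bar_pos[OF L])
  have w: "w > 0" "w < 1 / L\<Psi>"
    using adm const N by (auto simp: constant_step_def admissible_def)
  then have cubic_pos: "w\<^sup>2 * (1 - L\<Psi> * w) > 0" using L by (simp add: field_simps)
  have pos: "Gamma_seq \<alpha> k > 0" if "k \<in> {1..N}" for k
    using that adm by (intro Gamma_seq_pos) (auto simp: admissible_def)
  have bar_pos: "Gamma_seq alpha_bar k > 0" if "k \<in> {1..N}" for k
    using that alpha_bar_bounds[of k] by (simp add: Gamma_seq_alpha_bar)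
  have le: "Gamma_seq alpha_bar k \<le> Gamma_seq \<alpha> k" if "k \<in> {1..N}" for k
    using that adm admissible_alpha_square_le[OF adm const]
    by (intro Gamma_seq_alpha_bar_le) (auto simp: admissible_def)
  have sum_le: "(\<Sum>k=1..N. inverse (Gamma_seq \<alpha> k)) \<le> (\<Sum>k=1..N. inverse (Gamma_seq alpha_bar k))"
    using le bar_pos by (intro sum_mono le_imp_inverse_le) auto
  have sum_pos: "(\<Sum>k=1..N. inverse (Gamma_seq \<alpha> k)) > 0"
    using pos N by (intro sum_pos) auto
  \<comment> \<open>Since division by zero yields 0, comparing the reciprocals requires the smaller
    denominator to be positive; this rests on \<open>w < 1 / L\<Psi>\<close> and
    \<open>N \<ge> 1\<close>.\<close>
  have prod_pos: "(\<Sum>k=1..N. inverse (Gamma_seq \<alpha> k)) * (w\<^sup>2 * (1 - L\<Psi> * w)) > 0"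
    using sum_pos cubic_pos by (rule mult_pos_pos)
  have prod_le: "(\<Sum>k=1..N. inverse (Gamma_seq \<alpha> k)) * (w\<^sup>2 * (1 - L\<Psi> * w)) \<le>
      (\<Sum>k=1..N. inverse (Gamma_seq alpha_bar k)) *
      ((omega_bar L\<Psi>)\<^sup>2 * (1 - L\<Psi> * omega_bar L\<Psi>))"
    by (rule mult_mono[OF sum_le cubic_le_omega_bar[OF L w(1)]]) (use sum_le sum_pos cubic_pos in linarith)+
  show ?thesis
    unfolding complexity_bound_factored[OF Lh const] complexity_bound_factored[OF Lh const_bar]
    using prod_le prod_pos by (intro frac_le) simp_all
qed

theorem theorem1:
  fixes N :: nat and L\<Psi> Lh M :: real and x0 xs :: "real ^ 'n"
  assumes "N \<ge> 1" and "L\<Psi> > 0" and "Lh = 0"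
  shows "(\<forall>\<alpha> \<delta> \<omega> w. admissible N L\<Psi> \<alpha> \<delta> \<omega> \<and> constant_step N \<delta> \<omega> w \<longrightarrow>
            complexity_bound N L\<Psi> Lh M x0 xs \<alpha> \<delta> \<omega> =
            inverse (\<Sum>k=1..N. inverse (Gamma_seq \<alpha> k) * w * (1 - L\<Psi> * w)) *
            ((norm (x0 - xs))\<^sup>2 / w)) \<and>
         is_arg_min
           (\<lambda>(\<alpha>, \<delta>, \<omega>). complexity_bound N L\<Psi> Lh M x0 xs \<alpha> \<delta> \<omega>)
           (\<lambda>(\<alpha>, \<delta>, \<omega>). admissible N L\<Psi> \<alpha> \<delta> \<omega> \<and> (\<exists>w. constant_step N \<delta> \<omega> w))
           (alpha_bar, delta_bar L\<Psi>, \<lambda>k. omega_bar L\<Psi>)"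
proof (intro conjI allI impI)
  fix \<alpha> \<delta> \<omega> :: "nat \<Rightarrow> real" and w :: real
  assume "admissible N L\<Psi> \<alpha> \<delta> \<omega> \<and> constant_step N \<delta> \<omega> w"
  then show "complexity_bound N L\<Psi> Lh M x0 xs \<alpha> \<delta> \<omega> =
      inverse (\<Sum>k=1..N. inverse (Gamma_seq \<alpha> k) * w * (1 - L\<Psi> * w)) *
      ((norm (x0 - xs))\<^sup>2 / w)"
    using complexity_bound_eq[OF assms(3)] by blast
next
  have "constant_step N (delta_bar L\<Psi>) (\<lambda>k. omega_bar L\<Psi>) (omega_bar L\<Psi>)"
    by (simp add: constant_step_def delta_bar_def omega_bar_pos[OF assms(2)])
  then show "is_arg_min
      (\<lambda>(\<alpha>, \<delta>, \<omega>). complexity_bound N L\<Psi> Lh M x0 xs \<alpha> \<delta> \<omega>)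
      (\<lambda>(\<alpha>, \<delta>, \<omega>). admissible N L\<Psi> \<alpha> \<delta> \<omega> \<and> (\<exists>w. constant_step N \<delta> \<omega> w))
      (alpha_bar, delta_bar L\<Psi>, \<lambda>k. omega_bar L\<Psi>)"
    using admissible_bar[OF assms(2)]
    by (auto simp: is_arg_min_def not_less intro: complexity_bound_bar_le[OF assms])
qed

end
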